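(* Let $\mathfrak g$ be the six-dimensional real Lie algebra with basis $e_1,\dots,e_6$ whose non-zero brackets of basis vectors (up to skew-symmetry) are $$[e_5,e_1]=-e_2,\quad [e_5,e_2]=e_1,\quad [e_6,e_3]=-e_4,\quad [e_6,e_4]=e_3 .$$ Then for every symplectic form $\omega$ on $\mathfrak g$ there exists a Lie subalgebra $\mathfrak b$ of $\mathfrak g$ which is Lagrangian with respect to $\omega$.
   Context: A symplectic form on a Lie algebra $\mathfrak g$ is a non-degenerate alternating form $\omega$ with $\omega([u,v],w)+\omega([w,u],v)+\omega([v,w],u)=0$ for all $u,v,w\in\mathfrak g$. A subspace $W$ is Lagrangian if $W=W^{\perp_\omega}$, where $W^{\perp_\omega}=\{v:\omega(v,w)=0\ \forall w\in W\}$. The Lie algebra $\mathfrak g$ is the semi-direct sum of the abelian subalgebra $\langle e_5,e_6\rangle$ and the abelian ideal $\langle e_1,\dots,e_4\rangle$, with $e_5$ acting by $\begin{pmatrix}J&0\\0&0\end{pmatrix}$ and $e_6$ by $\begin{pmatrix}0&0\\0&J\end{pmatrix}$, where $J=\begin{pmatrix}0&1\\-1&0\end{pmatrix}$. *)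

theory Defs
  imports "HOL-Analysis.Analysis"
begin

definition lie_bracket :: "('g::real_vector \<Rightarrow> 'g \<Rightarrow> 'g) \<Rightarrow> bool" where
  "lie_bracket br \<longleftrightarrow> bilinear br \<and> (\<forall>u. br u u = 0) \<and>
     (\<forall>u v w. br u (br v w) + br v (br w u) + br w (br u v) = 0)"

definition lie_subalgebra :: "('g::real_vector \<Rightarrow> 'g \<Rightarrow> 'g) \<Rightarrow> 'g set \<Rightarrow> bool" where
  "lie_subalgebra br \<bb> \<longleftrightarrow> subspace \<bb> \<and> (\<forall>u\<in>\<bb>. \<forall>v\<in>\<bb>. br u v \<in> \<bb>)"

definition symplectic_form ::
    "('g::real_vector \<Rightarrow> 'g \<Rightarrow> 'g) \<Rightarrow> ('g \<Rightarrow> 'g \<Rightarrow> real) \<Rightarrow> bool" where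
  "symplectic_form br \<omega> \<longleftrightarrow> bilinear \<omega> \<and> (\<forall>u. \<omega> u u = 0) \<and>
     (\<forall>u. (\<forall>v. \<omega> u v = 0) \<longrightarrow> u = 0) \<and>
     (\<forall>u v w. \<omega> (br u v) w + \<omega> (br w u) v + \<omega> (br v w) u = 0)"

definition symplectic_complement :: "('g::real_vector \<Rightarrow> 'g \<Rightarrow> real) \<Rightarrow> 'g set \<Rightarrow> 'g set" where
  "symplectic_complement \<omega> W = {v. \<forall>w\<in>W. \<omega> v w = 0}"

definition lagrangian :: "('g::real_vector \<Rightarrow> 'g \<Rightarrow> real) \<Rightarrow> 'g set \<Rightarrow> bool" where
  "lagrangian \<omega> W \<longleftrightarrow> subspace W \<and> W = symplectic_complement \<omega> W"

definition basis6 :: "(nat \<Rightarrow> 'g::real_vector) \<Rightarrow> bool" where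
  "basis6 e \<longleftrightarrow> inj_on e {1..6} \<and> independent (e ` {1..6}) \<and> span (e ` {1..6}) = UNIV"

text \<open>The vanishing condition ranges over unordered pairs of indices; the listed brackets in the
  opposite order are determined by skew-symmetry of a Lie bracket.\<close>

definition structure_equations ::
    "('g::real_vector \<Rightarrow> 'g \<Rightarrow> 'g) \<Rightarrow> (nat \<Rightarrow> 'g) \<Rightarrow> bool" where
  "structure_equations br e \<longleftrightarrow>
     br (e 5) (e 1) = - e 2 \<and> br (e 5) (e 2) = e 1 \<and>
     br (e 6) (e 3) = - e 4 \<and> br (e 6) (e 4) = e 3 \<and>
     (\<forall>i\<in>{1..6}. \<forall>j\<in>{1..6}. {i, j} \<notin> {{5, 1}, {5, 2}, {6, 3}, {6, 4}} \<longrightarrow> br (e i) (e j) = 0)"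

text \<open>A model on \<open>\<complex>\<^sup>2 \<times> \<real>\<^sup>2\<close>: identifying \<open>e\<^sub>1, e\<^sub>2\<close> and \<open>e\<^sub>3, e\<^sub>4\<close> with \<open>1, \<i>\<close> in the two
  complex factors, the matrix \<open>J\<close> becomes multiplication by \<open>-\<i>\<close>.\<close>

lemma model_exists:
  "\<exists>(br :: complex \<times> complex \<times> real \<times> real \<Rightarrow> _ \<Rightarrow> _) e \<omega>.
     lie_bracket br \<and> basis6 e \<and> structure_equations br e \<and> symplectic_form br \<omega>"
proof -
  define br :: "complex \<times> complex \<times> real \<times> real \<Rightarrow> _ \<Rightarrow> complex \<times> complex \<times> real \<times> real"
    where "br = (\<lambda>(z, w, s, t) (z', w', s', t').
      (- \<i> * (of_real s * z' - of_real s' * z), - \<i> * (of_real t * w' - of_real t' * w), 0, 0))"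
  define e :: "nat \<Rightarrow> complex \<times> complex \<times> real \<times> real"
    where "e i = (if i = 1 then (1, 0, 0, 0) else if i = 2 then (\<i>, 0, 0, 0)
      else if i = 3 then (0, 1, 0, 0) else if i = 4 then (0, \<i>, 0, 0)
      else if i = 5 then (0, 0, 1, 0) else (0, 0, 0, 1))" for i
  define \<omega> :: "complex \<times> complex \<times> real \<times> real \<Rightarrow> complex \<times> complex \<times> real \<times> real \<Rightarrow> real"
    where "\<omega> = (\<lambda>(z, w, s, t) (z', w', s', t').
      Im (cnj z * z') + Im (cnj w * w') + (s * t' - t * s'))"
  have ivl: "{1..6} = {1, 2, 3, 4, 5, 6 :: nat}"
    by auto
  have "lie_bracket br"
    unfolding lie_bracket_def bilinear_def linear_iff br_def
    by (auto simp: algebra_simps scaleR_conv_of_real zero_prod_def)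
  moreover have "inj_on e {1..6}"
    unfolding ivl by (simp add: inj_on_def e_def complex_eq_iff)
  moreover have sp: "span (e ` {1..6}) = UNIV"
  proof (intro equalityI subsetI UNIV_I)
    fix x :: "complex \<times> complex \<times> real \<times> real"
    obtain z w s t where x: "x = (z, w, s, t)" by (cases x) auto
    have "x = Re z *\<^sub>R e 1 + Im z *\<^sub>R e 2 + Re w *\<^sub>R e 3 + Im w *\<^sub>R e 4 + s *\<^sub>R e 5 + t *\<^sub>R e 6"
      by (simp add: x e_def complex_eq_iff)
    also have "\<dots> \<in> span (e ` {1..6})"
      by (intro span_add span_scale span_base) auto
    finally show "x \<in> span (e ` {1..6})" .
  qed
  moreover have "independent (e ` {1..6})"
  proof (rule card_le_dim_spanning[of _ UNIV])
    show "card (e ` {1..6}) \<le> dim (UNIV :: (complex \<times> complex \<times> real \<times> real) set)"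
      using card_image_le[of "{1..6}" e] by simp
  qed (use sp in auto)
  moreover have "structure_equations br e"
    unfolding structure_equations_def ivl
    by (simp add: br_def e_def doubleton_eq_iff zero_prod_def)
  moreover have "symplectic_form br \<omega>"
  proof -
    have "x = 0" if *: "\<forall>y. \<omega> x y = 0" for x
    proof -
      obtain z w s t where x: "x = (z, w, s, t)" by (cases x) auto
      show ?thesis
        using *[rule_format, of "(1, 0, 0, 0)"] *[rule_format, of "(\<i>, 0, 0, 0)"]
          *[rule_format, of "(0, 1, 0, 0)"] *[rule_format, of "(0, \<i>, 0, 0)"]
          *[rule_format, of "(0, 0, 1, 0)"] *[rule_format, of "(0, 0, 0, 1)"]
        by (simp add: x \<omega>_def complex_eq_iff zero_prod_def)
    qed
    then show ?thesis
      unfolding symplectic_form_def bilinear_def linear_iff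
      by (auto simp: \<omega>_def br_def algebra_simps)
  qed
  ultimately show ?thesis
    unfolding basis6_def by blast
qed

end

theory Submission
  imports Defs
begin

text \<open>Closedness kills every \<open>\<omega>\<^sub>i\<^sub>j = \<omega> (e\<^sub>i) (e\<^sub>j)\<close> except \<open>\<omega>\<^sub>1\<^sub>2\<close>, \<open>\<omega>\<^sub>3\<^sub>4\<close>, \<open>\<omega>\<^sub>5\<^sub>6\<close>,
  \<open>\<omega>\<^sub>1\<^sub>5\<close>, \<open>\<omega>\<^sub>2\<^sub>5\<close>, \<open>\<omega>\<^sub>3\<^sub>6\<close>, \<open>\<omega>\<^sub>4\<^sub>6\<close>; the Pfaffian is then \<open>\<omega>\<^sub>1\<^sub>2 \<omega>\<^sub>3\<^sub>4 \<omega>\<^sub>5\<^sub>6\<close>, so these three are non-zero.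
  Choose \<open>\<sigma> = \<plusminus>1\<close> and \<open>c > 0\<close> with \<open>\<omega>\<^sub>1\<^sub>2 + \<sigma> c\<^sup>2 \<omega>\<^sub>3\<^sub>4 = 0\<close>. Then \<open>p = e\<^sub>1 + c e\<^sub>3\<close> and
  \<open>q = e\<^sub>2 + \<sigma> c e\<^sub>4\<close> span an isotropic plane which is invariant under \<open>e\<^sub>5 + \<sigma> e\<^sub>6\<close>. Since
  \<open>\<omega>\<^sub>1\<^sub>2 \<noteq> 0\<close>, adding to \<open>e\<^sub>5 + \<sigma> e\<^sub>6\<close> a suitable element of \<open>\<langle>e\<^sub>1, e\<^sub>2\<rangle>\<close> gives a vector orthogonal to this
  plane, which together with \<open>p, q\<close> spans a Lagrangian subalgebra.\<close>

declare One_nat_def [simp del]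

text \<open>Span induction in each argument in turn, since preimages of \<open>T\<close> under
  linear maps are subspaces. Taking \<open>T = span S\<close> reduces closure under brackets to
  generators, \<open>T = {0}\<close> does so for isotropy.\<close>

lemma bilinear_in_subspace:
  assumes "bilinear f" "subspace T" "\<And>x y. x \<in> S \<Longrightarrow> y \<in> S \<Longrightarrow> f x y \<in> T"
    and "u \<in> span S" "v \<in> span S"
  shows "f u v \<in> T"
proof -
  have lin: "linear (f x)" "linear (\<lambda>z. f z x)" for x
    using assms(1) by (auto simp: bilinear_def)
  have *: "f x v \<in> T" if "x \<in> S" for x
    using \<open>v \<in> span S\<close> linear_subspace_vimage[OF lin(1) assms(2)] assms(3) that
    by (auto simp: vimage_def intro: span_induct[of v S "\<lambda>z. f x z \<in> T"])
  show ?thesis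
    using \<open>u \<in> span S\<close> linear_subspace_vimage[OF lin(2) assms(2)] *
    by (auto simp: vimage_def intro: span_induct[of u S "\<lambda>z. f z v \<in> T"])
qed

lemma lie_subalgebra_span:
  assumes "bilinear br" "\<And>x y. x \<in> S \<Longrightarrow> y \<in> S \<Longrightarrow> br x y \<in> span S"
  shows "lie_subalgebra br (span S)"
  unfolding lie_subalgebra_def
  using bilinear_in_subspace[OF assms(1) subspace_span assms(2)] by auto

text \<open>Vanishing on generators puts \<open>span S\<close> inside its complement; the last
  premise yields the reverse inclusion directly, in place of a dimension count.\<close>

lemma lagrangian_span:
  assumes "bilinear \<omega>" "\<And>x y. x \<in> S \<Longrightarrow> y \<in> S \<Longrightarrow> \<omega> x y = 0"
    and "\<And>v. (\<And>x. x \<in> S \<Longrightarrow> \<omega> v x = 0) \<Longrightarrow> v \<in> span S"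
  shows "lagrangian \<omega> (span S)"
proof -
  have "\<omega> u v = 0" if "u \<in> span S" "v \<in> span S" for u v
    using bilinear_in_subspace[OF assms(1) subspace_single_0, of S] assms(2) that by simp
  moreover have "v \<in> span S" if "\<forall>w\<in>span S. \<omega> v w = 0" for v
    using that by (intro assms(3)) (simp add: span_base)
  ultimately show ?thesis
    unfolding lagrangian_def symplectic_complement_def by auto
qed

lemma atLeastAtMost_1_6: "{1..6} = {1, 2, 3, 4, 5, 6 :: nat}"
  by auto

lemma basis6_expand:
  assumes "basis6 e"
  obtains a1 a2 a3 a4 a5 a6 where "v = a1 *\<^sub>R e 1 + a2 *\<^sub>R e 2 + a3 *\<^sub>R e 3 + a4 *\<^sub>R e 4
    + a5 *\<^sub>R e 5 + a6 *\<^sub>R e 6"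
proof -
  have "v \<in> span (e ` {1..6})" and inj: "inj_on e {1..6}"
    using assms by (auto simp: basis6_def)
  then obtain a where "v = (\<Sum>x\<in>e ` {1..6}. a x *\<^sub>R x)"
    by (auto simp: span_finite)
  then have "v = (\<Sum>i\<in>{1..6}. a (e i) *\<^sub>R e i)"
    by (simp add: sum.reindex[OF inj])
  then show ?thesis
    by (intro that[of "a (e 1)" "a (e 2)" "a (e 3)" "a (e 4)" "a (e 5)" "a (e 6)"])
      (simp add: atLeastAtMost_1_6 add.assoc)
qed

lemma basis6_coeffs_eq_0:
  assumes "basis6 e" "(\<Sum>i\<in>{1..6}. a i *\<^sub>R e i) = 0" "i \<in> {1..6}"
  shows "a i = 0"
proof -
  have inj: "inj_on e {1..6}" and ind: "independent (e ` {1..6})"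
    using assms by (auto simp: basis6_def)
  have "(\<Sum>x\<in>e ` {1..6}. a (the_inv_into {1..6} e x) *\<^sub>R x) = 0"
    using assms(2) by (simp add: sum.reindex[OF inj] the_inv_into_f_f[OF inj])
  then have "a (the_inv_into {1..6} e (e i)) = 0"
    using assms(3)
    by (intro independentD[OF ind, of "e ` {1..6}" "\<lambda>x. a (the_inv_into {1..6} e x)"]) auto
  then show ?thesis
    by (simp add: the_inv_into_f_f[OF inj assms(3)])
qed

lemma symplectic_form_skew:
  assumes "symplectic_form br \<omega>"
  shows "\<omega> y x = - \<omega> x y"
proof -
  have bil: "bilinear \<omega>" and alt: "\<omega> u u = 0" for u
    using assms by (auto simp: symplectic_form_def)
  show ?thesis
    using alt[of "x + y"] alt[of x] alt[of y] by (simp add: bilinear_ladd[OF bil] bilinear_radd[OF bil])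
qed

lemma lie_bracket_skew:
  assumes "lie_bracket br"
  shows "br y x = - br x y"
proof -
  have bil: "bilinear br" and alt: "br u u = 0" for u
    using assms by (auto simp: lie_bracket_def)
  show ?thesis
    using alt[of "x + y"] alt[of x] alt[of y]
    by (simp add: bilinear_ladd[OF bil] bilinear_radd[OF bil] eq_neg_iff_add_eq_0 add.commute)
qed

lemma symplectic_kernel_trivial:
  assumes "symplectic_form br \<omega>" "basis6 e"
    and "\<omega> u (e 1) = 0" "\<omega> u (e 2) = 0" "\<omega> u (e 3) = 0"
      "\<omega> u (e 4) = 0" "\<omega> u (e 5) = 0" "\<omega> u (e 6) = 0"
  shows "u = 0"
proof -
  have bil: "bilinear \<omega>" and nd: "(\<forall>v. \<omega> u v = 0) \<Longrightarrow> u = 0"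
    using assms(1) by (auto simp: symplectic_form_def)
  have "\<omega> u v = 0" for v
    by (rule basis6_expand[OF assms(2), of v])
      (simp add: bilinear_radd[OF bil] bilinear_rmul[OF bil] assms)
  with nd show ?thesis by blast
qed

theorem lemma3p18:
  fixes br :: "'g::real_vector \<Rightarrow> 'g \<Rightarrow> 'g"
    and e :: "nat \<Rightarrow> 'g"
    and \<omega> :: "'g \<Rightarrow> 'g \<Rightarrow> real"
  assumes "lie_bracket br"
    and "basis6 e"
    and "structure_equations br e"
    and "symplectic_form br \<omega>"
  shows "\<exists>\<bb>. lie_subalgebra br \<bb> \<and> lagrangian \<omega> \<bb>"
proof -
  have bil: "bilinear \<omega>" and alt: "\<omega> u u = 0"
    and closed: "\<omega> (br u v) w + \<omega> (br w u) v + \<omega> (br v w) u = 0" for u v w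
    using assms(4) by (auto simp: symplectic_form_def)
  have bilb: "bilinear br" and altb: "br u u = 0" for u
    using assms(1) by (auto simp: lie_bracket_def)
  note skew = symplectic_form_skew[OF assms(4)]
  note skewb = lie_bracket_skew[OF assms(1)]
  note lin = bilinear_ladd[OF bil] bilinear_radd[OF bil] bilinear_lmul[OF bil] bilinear_rmul[OF bil]
    bilinear_lneg[OF bil] bilinear_rneg[OF bil] bilinear_lzero[OF bil] bilinear_rzero[OF bil]
    bilinear_lsub[OF bil] bilinear_rsub[OF bil]
  note linb = bilinear_ladd[OF bilb] bilinear_radd[OF bilb] bilinear_lmul[OF bilb]
    bilinear_rmul[OF bilb]
  have br1: "br (e 5) (e 1) = - e 2" "br (e 5) (e 2) = e 1"
      "br (e 6) (e 3) = - e 4" "br (e 6) (e 4) = e 3"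
    and br0: "\<And>i j. i \<in> {1..6} \<Longrightarrow> j \<in> {1..6} \<Longrightarrow>
      {i, j} \<notin> {{5, 1}, {5, 2}, {6, 3}, {6, 4}} \<Longrightarrow> br (e i) (e j) = 0"
    using assms(3) by (simp_all add: structure_equations_def)
  have br2: "br (e 1) (e 5) = e 2" "br (e 2) (e 5) = - e 1"
      "br (e 3) (e 6) = e 4" "br (e 4) (e 6) = - e 3"
    by (simp_all add: br1 skewb[of "e 1" "e 5"] skewb[of "e 2" "e 5"]
        skewb[of "e 3" "e 6"] skewb[of "e 4" "e 6"])
  note brs = br1 br2 br0 doubleton_eq_iff
  \<comment> \<open>In each triple below exactly one bracket is non-zero, so closedness isolates a
    single coefficient.\<close>
  have w0: "\<omega> (e 1) (e 3) = 0" "\<omega> (e 1) (e 4) = 0" "\<omega> (e 2) (e 3) = 0" "\<omega> (e 2) (e 4) = 0"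
      "\<omega> (e 1) (e 6) = 0" "\<omega> (e 2) (e 6) = 0" "\<omega> (e 3) (e 5) = 0" "\<omega> (e 4) (e 5) = 0"
    using closed[of "e 2" "e 3" "e 5"] closed[of "e 2" "e 4" "e 5"] closed[of "e 1" "e 3" "e 5"]
      closed[of "e 1" "e 4" "e 5"] closed[of "e 2" "e 5" "e 6"] closed[of "e 1" "e 5" "e 6"]
      closed[of "e 4" "e 5" "e 6"] closed[of "e 3" "e 5" "e 6"]
    by (simp_all add: brs lin)
  define a b d where "a = \<omega> (e 1) (e 2)" and "b = \<omega> (e 3) (e 4)" and "d = \<omega> (e 5) (e 6)"
  define r1 r2 r3 r4 where "r1 = \<omega> (e 1) (e 5)" and "r2 = \<omega> (e 2) (e 5)"
    and "r3 = \<omega> (e 3) (e 6)" and "r4 = \<omega> (e 4) (e 6)"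
  have w1: "\<omega> (e 1) (e 2) = a" "\<omega> (e 3) (e 4) = b" "\<omega> (e 5) (e 6) = d" "\<omega> (e 1) (e 5) = r1"
      "\<omega> (e 2) (e 5) = r2" "\<omega> (e 3) (e 6) = r3" "\<omega> (e 4) (e 6) = r4"
    by (simp_all add: a_def b_def d_def r1_def r2_def r3_def r4_def)
  \<comment> \<open>The guard \<open>j < i\<close> makes skew-symmetry a terminating rewrite rule
    that puts the smaller index first.\<close>
  have w2: "\<omega> (e i) (e j) = - \<omega> (e j) (e i)" if "j < i" for i j
    by (rule skew)
  note ws = w0 w1 w2 alt lin
  note kernel = symplectic_kernel_trivial[OF assms(4,2)]
  note coeffs = basis6_coeffs_eq_0[OF assms(2), unfolded atLeastAtMost_1_6]
  have ne: "e i \<noteq> 0" if "i \<in> {1..6}" for i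
    using assms(2) that dependent_zero[of "e ` {1..6}"] unfolding basis6_def by (metis imageI)
  \<comment> \<open>If \<open>a = 0\<close>, then \<open>e 1\<close> and \<open>e 2\<close> pair
    non-trivially with \<open>e 5\<close> at most, so a combination of them lies in the kernel; its
    vanishing gives \<open>r1 = r2 = 0\<close>, which puts \<open>e 1\<close> itself in the kernel.
    The argument for \<open>b\<close> is the same with \<open>e 3\<close>, \<open>e 4\<close>,
    \<open>e 6\<close>.\<close>
  have "a \<noteq> 0"
  proof
    assume "a = 0"
    then have "r2 *\<^sub>R e 1 - r1 *\<^sub>R e 2 = 0"
      by (intro kernel) (simp_all add: ws)
    then have "r1 = 0" "r2 = 0"
      using coeffs[of "(\<lambda>_. 0)(1 := r2, 2 := - r1)" 1] coeffs[of "(\<lambda>_. 0)(1 := r2, 2 := - r1)" 2]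
      by simp_all
    with \<open>a = 0\<close> have "e 1 = 0"
      by (intro kernel) (simp_all add: ws)
    with ne show False by simp
  qed
  have "b \<noteq> 0"
  proof
    assume "b = 0"
    then have "r4 *\<^sub>R e 3 - r3 *\<^sub>R e 4 = 0"
      by (intro kernel) (simp_all add: ws)
    then have "r3 = 0" "r4 = 0"
      using coeffs[of "(\<lambda>_. 0)(3 := r4, 4 := - r3)" 3] coeffs[of "(\<lambda>_. 0)(3 := r4, 4 := - r3)" 4]
      by simp_all
    with \<open>b = 0\<close> have "e 3 = 0"
      by (intro kernel) (simp_all add: ws)
    with ne show False by simp
  qed
  \<comment> \<open>The terms in \<open>e 1\<close> and \<open>e 2\<close> cancel the pairings of
    \<open>a *\<^sub>R e 5\<close> with \<open>e 2\<close> and \<open>e 1\<close>; the pairing with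
    \<open>e 6\<close> is \<open>a * d\<close>.\<close>
  have "d \<noteq> 0"
  proof
    assume "d = 0"
    then have "a *\<^sub>R e 5 + r2 *\<^sub>R e 1 - r1 *\<^sub>R e 2 = 0"
      by (intro kernel) (simp_all add: ws)
    then have "a = 0"
      using coeffs[of "(\<lambda>_. 0)(1 := r2, 2 := - r1, 5 := a)" 5] by (simp add: algebra_simps)
    with \<open>a \<noteq> 0\<close> show False ..
  qed
  define \<sigma> where "\<sigma> = - sgn (a / b)"
  define c where "c = sqrt \<bar>a / b\<bar>"
  have \<sigma>2: "\<sigma> * \<sigma> = 1" and c: "c \<noteq> 0"
    using \<open>a \<noteq> 0\<close> \<open>b \<noteq> 0\<close> by (auto simp: \<sigma>_def c_def sgn_if)
  have "\<sigma> * (c * c) = - (a / b)"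
    using sgn_mult_abs[of "a / b"] by (simp add: \<sigma>_def c_def del: sgn_divide abs_divide)
  then have acb: "a + \<sigma> * c * c * b = 0"
    using \<open>b \<noteq> 0\<close> by (simp add: field_simps)
  define p q where "p = e 1 + c *\<^sub>R e 3" and "q = e 2 + (\<sigma> * c) *\<^sub>R e 4"
  \<comment> \<open>\<open>\<beta>\<close> solves \<open>\<omega> x p = 0\<close> and
    \<open>\<alpha>\<close> solves \<open>\<omega> x q = 0\<close>.\<close>
  define \<alpha> \<beta> where "\<alpha> = (r2 + c * r4) / a" and "\<beta> = - (r1 + \<sigma> * c * r3) / a"
  define x where "x = e 5 + \<sigma> *\<^sub>R e 6 + \<alpha> *\<^sub>R e 1 + \<beta> *\<^sub>R e 2"
  have \<alpha>\<beta>: "\<alpha> * a = r2 + c * r4" "\<beta> * a = - (r1 + \<sigma> * c * r3)"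
    using \<open>a \<noteq> 0\<close> by (simp_all add: \<alpha>_def \<beta>_def)
  have pq: "\<omega> p q = 0"
    using acb by (simp add: p_def q_def ws algebra_simps)
  have xp: "\<omega> x p = 0"
    using \<alpha>\<beta> by (simp add: p_def x_def ws algebra_simps)
  have xq: "\<omega> x q = 0"
    using \<alpha>\<beta> \<sigma>2 by (simp add: q_def x_def ws algebra_simps)
  have bpq: "br p q = 0"
    by (simp add: p_def q_def brs linb)
  \<comment> \<open>The part of \<open>x\<close> in \<open>e 1\<close>, \<open>e 2\<close> commutes
    with \<open>p\<close> and \<open>q\<close>. The sign in \<open>q\<close> matches that of
    \<open>e 6\<close> in \<open>x\<close>, so \<open>x\<close> rotates the plane of
    \<open>p\<close> and \<open>q\<close>.\<close>
  have bxp: "br x p = - q"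
    by (simp add: p_def q_def x_def brs linb algebra_simps)
  have bxq: "br x q = p"
    using \<sigma>2 by (simp add: p_def q_def x_def brs linb algebra_simps flip: mult.assoc)
  let ?S = "{p, q, x}"
  have inS: "p \<in> span ?S" "q \<in> span ?S" "x \<in> span ?S"
    by (auto intro: span_base)
  have "lie_subalgebra br (span ?S)"
    using bpq bxp bxq skewb[of q p] skewb[of p x] skewb[of q x] inS
    by (intro lie_subalgebra_span[OF bilb]) (auto simp: altb span_zero span_neg)
  moreover have "lagrangian \<omega> (span ?S)"
  proof (rule lagrangian_span[OF bil])
    show "\<omega> u v = 0" if "u \<in> ?S" "v \<in> ?S" for u v
      using that pq xp xq skew[of q p] skew[of p x] skew[of q x] by (auto simp: alt)
  next
    fix v assume v: "\<And>u. u \<in> ?S \<Longrightarrow> \<omega> v u = 0"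
    obtain v1 v2 v3 v4 v5 v6 where v_eq: "v = v1 *\<^sub>R e 1 + v2 *\<^sub>R e 2 + v3 *\<^sub>R e 3 + v4 *\<^sub>R e 4
        + v5 *\<^sub>R e 5 + v6 *\<^sub>R e 6"
      using basis6_expand[OF assms(2)] .
    \<comment> \<open>The vector \<open>s\<close> of the span agrees with \<open>v\<close> in the
      coordinates 1, 2 and 5; by isotropy \<open>v - s\<close> stays orthogonal to the
      generators.\<close>
    define s where "s = v5 *\<^sub>R x + (v1 - v5 * \<alpha>) *\<^sub>R p + (v2 - v5 * \<beta>) *\<^sub>R q"
    define y3 y4 y6 where "y3 = v3 - (v1 - v5 * \<alpha>) * c"
      and "y4 = v4 - (v2 - v5 * \<beta>) * (\<sigma> * c)" and "y6 = v6 - v5 * \<sigma>"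
    have s: "s \<in> span ?S"
      unfolding s_def using inS by (intro span_add span_scale)
    have vs: "v - s = y3 *\<^sub>R e 3 + y4 *\<^sub>R e 4 + y6 *\<^sub>R e 6"
      by (simp add: v_eq s_def x_def p_def q_def y3_def y4_def y6_def algebra_simps)
    have orth: "\<omega> (v - s) p = 0" "\<omega> (v - s) q = 0" "\<omega> (v - s) x = 0"
      using v[of p] v[of q] v[of x] pq xp xq skew[of q p] skew[of p x] skew[of q x]
      by (simp_all add: s_def lin alt)
    have "\<sigma> \<noteq> 0"
      using \<sigma>2 by auto
    have "c * (y4 * b + y6 * r3) = 0" "\<sigma> * c * (y3 * b - y6 * r4) = 0"
      and eq3: "\<sigma> * (y3 * r3 + y4 * r4) - y6 * d = 0"
      using orth by (simp_all add: vs p_def q_def x_def ws algebra_simps)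
    then have eq1: "y4 * b = - y6 * r3" and eq2: "y3 * b = y6 * r4"
      using c \<open>\<sigma> \<noteq> 0\<close> by auto
    \<comment> \<open>By \<open>eq1\<close> and \<open>eq2\<close> the two terms are
      \<open>y6 * r4 * r3\<close> and its negative, so \<open>eq3\<close> reduces to
      \<open>y6 * d = 0\<close>.\<close>
    have "b * (y3 * r3 + y4 * r4) = (y3 * b) * r3 + (y4 * b) * r4"
      by (simp add: algebra_simps)
    also have "\<dots> = 0"
      by (simp add: eq1 eq2)
    finally have "y6 = 0"
      using eq3 \<open>b \<noteq> 0\<close> \<open>d \<noteq> 0\<close> by simp
    with eq1 eq2 \<open>b \<noteq> 0\<close> have "v - s = 0"
      by (simp add: vs)
    with s show "v \<in> span ?S" by simp
  qed
  ultimately show ?thesis by blast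
qed

end
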